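(* Let $\mathbb{F}$ be an algebraically closed field, $V$ an $n$-dimensional vector space over $\mathbb{F}$, $G=\mathrm{GL}(V)$, and $\mathcal{N}$ the variety of nilpotent endomorphisms of $V$. The set of $G$-orbits in $V\times\mathcal{N}$ is in one-to-one correspondence with the set $\mathcal{Q}_n$ of bipartitions of $n$. The orbit corresponding to $(\mu;\nu)\in\mathcal{Q}_n$, denoted $\mathcal{O}_{\mu;\nu}$, consists of those pairs $(v,x)\in V\times\mathcal{N}$ for which there exists a normal basis of type $(\mu;\nu)$.
   Context: $G$ acts on $V\times\mathcal{N}$ by $g\cdot(v,x)=(gv,gxg^{-1})$. A partition is a nonincreasing sequence $\lambda=(\lambda_1,\lambda_2,\dots)$ of nonnegative integers with finitely many nonzero terms; $|\lambda|=\sum_i\lambda_i$, and $\ell(\lambda)$ is the number of nonzero terms. $\mathcal{Q}_n$ is the set of ordered pairs of partitions $(\mu;\nu)$ with $|\mu|+|\nu|=n$ (bipartitions of $n$). A Jordan basis for $x\in\mathcal{N}$ of Jordan type $\lambda$ is a basis $\{v_{ij}\mid 1\le i\le\ell(\lambda),\,1\le j\le\lambda_i\}$ of $V$ such that $xv_{ij}=v_{i,j-1}$ if $j>1$ and $xv_{i1}=0$. A normal basis for $(v,x)\in V\times\mathcal{N}$, where $x$ has Jordan type $\lambda$, is a Jordan basis $\{v_{ij}\}$ for $x$ such that $v=\sum_{i=1}^{\ell(\mu)}v_{i,\mu_i}$, where $\mu$ is a partition such that $\nu_i=\lambda_i-\mu_i$ defines a partition $\nu$; the bipartition $(\mu;\nu)\in\mathcal{Q}_n$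 is the type of the normal basis. *)

theory Defs
  imports
    "HOL-Algebra.Group_Action"
    "HOL-Computational_Algebra.Polynomial"
begin

text \<open>
  Parts are indexed from 0, so \<open>p i\<close> is the part usually written with index \<open>i + 1\<close>.
\<close>

definition int_partition :: "(nat \<Rightarrow> nat) \<Rightarrow> bool" where
  "int_partition p \<longleftrightarrow> antimono p \<and> finite {i. p i \<noteq> 0}"

definition partition_size :: "(nat \<Rightarrow> nat) \<Rightarrow> nat" where
  "partition_size p = (\<Sum>i | p i \<noteq> 0. p i)"

definition partition_length :: "(nat \<Rightarrow> nat) \<Rightarrow> nat" where
  "partition_length p = card {i. p i \<noteq> 0}"

definition bipartitions :: "nat \<Rightarrow> ((nat \<Rightarrow> nat) \<times> (nat \<Rightarrow> nat)) set" where
  "bipartitions n = {(\<mu>, \<nu>). int_partition \<mu> \<and> int_partition \<nu> \<and>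
     partition_size \<mu> + partition_size \<nu> = n}"

text \<open>
  The vector space \<open>V\<close> is the whole type \<open>'v\<close>, with scalar multiplication \<open>scale\<close>.
\<close>

definition GL_group :: "('f::field \<Rightarrow> 'v::ab_group_add \<Rightarrow> 'v) \<Rightarrow> ('v \<Rightarrow> 'v) monoid" where
  "GL_group scale =
     \<lparr>carrier = {g. Vector_Spaces.linear scale scale g \<and> bij g}, monoid.mult = (\<circ>), one = id\<rparr>"

definition nilpotent_endos :: "('f::field \<Rightarrow> 'v::ab_group_add \<Rightarrow> 'v) \<Rightarrow> ('v \<Rightarrow> 'v) set" where
  "nilpotent_endos scale =
     {x. Vector_Spaces.linear scale scale x \<and> (\<exists>k. x ^^ k = (\<lambda>_. 0))}"

text \<open>
  The restriction to \<open>V \<times> \<N>\<close> is there because \<^const>\<open>group_action\<close> asks for extensional functions.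
\<close>

definition GL_action ::
    "('f::field \<Rightarrow> 'v::ab_group_add \<Rightarrow> 'v) \<Rightarrow> ('v \<Rightarrow> 'v) \<Rightarrow> 'v \<times> ('v \<Rightarrow> 'v) \<Rightarrow> 'v \<times> ('v \<Rightarrow> 'v)" where
  "GL_action scale g =
     restrict (\<lambda>(v, x). (g v, g \<circ> x \<circ> inv_into UNIV g)) (UNIV \<times> nilpotent_endos scale)"

text \<open>
  Rows are indexed from 0 (as are the parts of \<open>\<lambda>\<close>), positions within a row from 1.
\<close>

definition young_boxes :: "(nat \<Rightarrow> nat) \<Rightarrow> (nat \<times> nat) set" where
  "young_boxes l = {(i, j). i < partition_length l \<and> 1 \<le> j \<and> j \<le> l i}"

definition is_jordan_basis ::
    "('f::field \<Rightarrow> 'v::ab_group_add \<Rightarrow> 'v) \<Rightarrow> ('v \<Rightarrow> 'v) \<Rightarrow> (nat \<Rightarrow> nat) \<Rightarrow> (nat \<Rightarrow> nat \<Rightarrow> 'v) \<Rightarrow> bool" where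
  "is_jordan_basis scale x l b \<longleftrightarrow>
     int_partition l \<and>
     inj_on (\<lambda>(i, j). b i j) (young_boxes l) \<and>
     module.independent scale ((\<lambda>(i, j). b i j) ` young_boxes l) \<and>
     module.span scale ((\<lambda>(i, j). b i j) ` young_boxes l) = UNIV \<and>
     (\<forall>(i, j) \<in> young_boxes l. x (b i j) = (if j > 1 then b i (j - 1) else 0))"

text \<open>
  The Jordan type \<open>\<lambda>\<close> of \<open>x\<close> is determined by the type of the normal basis: requiring that
  \<open>\<nu>\<^sub>i = \<lambda>\<^sub>i - \<mu>\<^sub>i\<close> be a partition amounts to \<open>\<lambda> = \<mu> + \<nu>\<close>.
\<close>

definition is_normal_basis ::
    "('f::field \<Rightarrow> 'v::ab_group_add \<Rightarrow> 'v) \<Rightarrow> 'v \<Rightarrow> ('v \<Rightarrow> 'v) \<Rightarrow>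
     (nat \<Rightarrow> nat) \<Rightarrow> (nat \<Rightarrow> nat) \<Rightarrow> (nat \<Rightarrow> nat \<Rightarrow> 'v) \<Rightarrow> bool" where
  "is_normal_basis scale v x \<mu> \<nu> b \<longleftrightarrow>
     int_partition \<mu> \<and> int_partition \<nu> \<and>
     is_jordan_basis scale x (\<lambda>i. \<mu> i + \<nu> i) b \<and>
     v = (\<Sum>i < partition_length \<mu>. b i (\<mu> i))"

lemma linear_inv_GL:
  assumes "g \<in> carrier (GL_group scale)"
  shows "inv_into UNIV g \<in> carrier (GL_group scale)"
  using assms unfolding GL_group_def
  by (auto simp: linear_iff_module_hom bij_module_hom_imp_inv_module_hom bij_imp_bij_inv)

lemma group_GL_group:
  assumes "vector_space scale"
  shows "group (GL_group scale)"
proof (rule groupI)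
  fix g assume g: "g \<in> carrier (GL_group scale)"
  then have "inv_into UNIV g \<circ> g = id" by (auto simp: GL_group_def bij_is_inj)
  with linear_inv_GL[OF g]
  show "\<exists>h\<in>carrier (GL_group scale). h \<otimes>\<^bsub>GL_group scale\<^esub> g = \<one>\<^bsub>GL_group scale\<^esub>"
    by (auto simp: GL_group_def)
next
  show "\<one>\<^bsub>GL_group scale\<^esub> \<in> carrier (GL_group scale)"
    using vector_space.linear_id[OF assms] by (simp add: GL_group_def)
next
  fix g h assume "g \<in> carrier (GL_group scale)" "h \<in> carrier (GL_group scale)"
  then show "g \<otimes>\<^bsub>GL_group scale\<^esub> h \<in> carrier (GL_group scale)"
    using module_hom_compose[of scale scale h scale g]
    by (simp add: GL_group_def bij_comp linear_iff_module_hom)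
qed (simp_all add: GL_group_def comp_assoc)

lemma conj_nilpotent:
  assumes g: "g \<in> carrier (GL_group scale)" and x: "x \<in> nilpotent_endos scale"
  shows "g \<circ> x \<circ> inv_into UNIV g \<in> nilpotent_endos scale"
proof -
  from x obtain k where k: "x ^^ k = (\<lambda>_. 0)" by (auto simp: nilpotent_endos_def)
  have lin: "module_hom scale scale g" "module_hom scale scale x" and b: "bij g"
    using g x by (auto simp: GL_group_def nilpotent_endos_def linear_iff_module_hom)
  have ig: "inv_into UNIV g (g v) = v" "g (inv_into UNIV g v) = v" for v
    using b by (simp_all add: bij_is_inj bij_is_surj surj_f_inv_f)
  have "(g \<circ> x \<circ> inv_into UNIV g) ^^ m = g \<circ> x ^^ m \<circ> inv_into UNIV g" for m
    by (induction m) (auto simp: fun_eq_iff ig)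
  then have "(g \<circ> x \<circ> inv_into UNIV g) ^^ k = (\<lambda>_. 0)"
    using k module_hom.zero[OF lin(1)] by (auto simp: fun_eq_iff)
  moreover have "module_hom scale scale (g \<circ> x \<circ> inv_into UNIV g)"
    using lin b by (intro module_hom_compose bij_module_hom_imp_inv_module_hom)
  ultimately show ?thesis
    by (auto simp: nilpotent_endos_def linear_iff_module_hom)
qed

lemma GL_group_action:
  assumes vs: "vector_space scale"
  shows "group_action (GL_group scale) (UNIV \<times> nilpotent_endos scale) (GL_action scale)"
proof -
  let ?E = "UNIV \<times> nilpotent_endos scale"
  have maps: "GL_action scale g p \<in> ?E" if "g \<in> carrier (GL_group scale)" "p \<in> ?E" for g p
    using that conj_nilpotent[of g scale] by (auto simp: GL_action_def)
  have comp: "GL_action scale (g \<circ> h) p = GL_action scale g (GL_action scale h p)"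
    if gh: "g \<in> carrier (GL_group scale)" "h \<in> carrier (GL_group scale)" and p: "p \<in> ?E" for g h p
  proof -
    have "inv_into UNIV (g \<circ> h) = inv_into UNIV h \<circ> inv_into UNIV g"
      using gh by (intro o_inv_distrib) (auto simp: GL_group_def)
    then show ?thesis
      using maps[OF gh(2) p] p by (auto simp: GL_action_def comp_assoc)
  qed
  have one: "GL_action scale id p = p" if "p \<in> ?E" for p
    using that by (auto simp: GL_action_def)
  have bijE: "GL_action scale g \<in> Bij ?E" if g: "g \<in> carrier (GL_group scale)" for g
  proof -
    have "inv_into UNIV g \<circ> g = id" "g \<circ> inv_into UNIV g = id"
      using g by (auto simp: GL_group_def bij_is_inj bij_is_surj surj_iff[symmetric])
    then have "\<forall>p\<in>?E. GL_action scale (inv_into UNIV g) (GL_action scale g p) = p"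
        "\<forall>p\<in>?E. GL_action scale g (GL_action scale (inv_into UNIV g) p) = p"
      using comp[OF g linear_inv_GL[OF g]] comp[OF linear_inv_GL[OF g] g] one by metis+
    then have "bij_betw (GL_action scale g) ?E ?E"
      by (rule bij_betw_byWitness)
        (use maps[OF g] maps[OF linear_inv_GL[OF g]] in \<open>simp_all only: image_subset_iff ball_simps\<close>, blast+)
    moreover have "GL_action scale g \<in> extensional ?E"
      by (simp add: GL_action_def)
    ultimately show ?thesis by (simp add: Bij_def)
  qed
  have "GL_action scale \<in> hom (GL_group scale) (BijGroup ?E)"
  proof (rule homI)
    fix g h assume gh: "g \<in> carrier (GL_group scale)" "h \<in> carrier (GL_group scale)"
    have "GL_action scale (g \<circ> h) = compose ?E (GL_action scale g) (GL_action scale h)"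
      using comp[OF gh] by (intro ext) (auto simp: compose_def GL_action_def)
    then show "GL_action scale (g \<otimes>\<^bsub>GL_group scale\<^esub> h) =
        GL_action scale g \<otimes>\<^bsub>BijGroup ?E\<^esub> GL_action scale h"
      using bijE gh by (simp add: BijGroup_def GL_group_def)
  qed (use bijE in \<open>simp add: BijGroup_def\<close>)
  then show ?thesis
    using group_GL_group[OF vs] group_BijGroup
    by (auto simp: group_action_def group_hom_def group_hom_axioms_def)
qed

end

theory Submission
  imports Defs
begin

text \<open>
  View \<open>V\<close> as a module over the polynomials in \<open>x\<close>, generated by vectors \<open>u i\<close> of nilpotency order
  \<open>l i\<close>.  If \<open>\<Sum>i. l i\<close> is minimal, the cyclic modules of the \<open>u i\<close> form a direct sum: in a linear
  relation, factor out the lowest power of \<open>x\<close> and replace a generator occurring there by the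
  cofactor, which has smaller order.  After changing each generator by a unit,
  \<open>v = (\<Sum>i. (x ^^ k i) (u i))\<close>.  If \<open>\<Sum>i. k i\<close> is minimal, then the pairs
  \<open>(l i - k i, k i)\<close> form a chain, so that \<open>\<mu> i = l i - k i\<close> and \<open>\<nu> i = k i\<close> are partitions.

  Conversely, \<open>\<mu> + \<nu>\<close> is determined by the ranks of the powers of \<open>x\<close>, and \<open>\<mu>\<close> by the set of
  \<open>(k, h)\<close> with \<open>v \<in> ker x\<^sup>k + im x\<^sup>h\<close>.
\<close>

section \<open>Partitions and Young diagrams\<close>

text \<open>Monotonicity makes the support an initial segment of the indices, so its cardinality is
  also the first index carrying a zero part. This lets \<open>partition_length\<close> serve as a
  cutoff everywhere below.\<close>

lemma nonzero_part_iff: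
  assumes "int_partition p"
  shows "p i \<noteq> 0 \<longleftrightarrow> i < partition_length p"
proof -
  have anti: "antimono p" and fin: "finite {i. p i \<noteq> 0}"
    using assms by (auto simp: int_partition_def)
  show ?thesis
  proof
    assume "p i \<noteq> 0"
    then have "{..i} \<subseteq> {i. p i \<noteq> 0}"
      using antimonoD[OF anti] by fastforce
    from card_mono[OF fin this] show "i < partition_length p"
      by (simp add: partition_length_def)
  next
    assume i: "i < partition_length p"
    show "p i \<noteq> 0"
    proof
      assume "p i = 0"
      then have "j < i" if "p j \<noteq> 0" for j
        using antimonoD[OF anti, of i j] that by (cases "i \<le> j") auto
      then have "{i. p i \<noteq> 0} \<subseteq> {..<i}"
        by auto
      from card_mono[OF _ this] i show False
        by (simp add: partition_length_def)
    qed
  qed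
qed

lemma int_partitionI:
  assumes "antimono p" "p m = 0"
  shows "int_partition p"
proof -
  have "i < m" if "p i \<noteq> 0" for i
    using antimonoD[OF assms(1), of m i] assms(2) that by (cases "m \<le> i") auto
  then have "{i. p i \<noteq> 0} \<subseteq> {..<m}"
    by auto
  then have "finite {i. p i \<noteq> 0}"
    by (rule finite_subset) simp
  with assms(1) show ?thesis
    by (simp add: int_partition_def)
qed

lemma partition_length_le:
  assumes "int_partition p" "p m = 0"
  shows "partition_length p \<le> m"
  using nonzero_part_iff[OF assms(1), of m] assms(2) by simp

lemma partition_size_eq_sum:
  assumes "\<And>i. i \<ge> m \<Longrightarrow> p i = 0"
  shows "partition_size p = sum p {..<m}"
proof -
  have "i < m" if "p i \<noteq> 0" for i
    using assms that by (meson not_less)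
  then show ?thesis
    unfolding partition_size_def by (intro sum.mono_neutral_left) auto
qed

lemma int_partition_add:
  assumes "int_partition \<mu>" "int_partition \<nu>"
  shows "int_partition (\<lambda>i. \<mu> i + \<nu> i)"
proof -
  have "{i. \<mu> i + \<nu> i \<noteq> 0} = {i. \<mu> i \<noteq> 0} \<union> {i. \<nu> i \<noteq> 0}"
    by auto
  with assms show ?thesis
    unfolding int_partition_def by (auto simp: monotone_on_def intro: add_mono)
qed

lemma int_partition_vanishes:
  assumes "int_partition p"
  obtains m where "\<And>i. i \<ge> m \<Longrightarrow> p i = 0"
  using nonzero_part_iff[OF assms] by (metis not_less)

lemma partition_size_add:
  assumes "int_partition \<mu>" "int_partition \<nu>"
  shows "partition_size (\<lambda>i. \<mu> i + \<nu> i) = partition_size \<mu> + partition_size \<nu>"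
proof -
  obtain m where "\<And>i. i \<ge> m \<Longrightarrow> \<mu> i = 0"
    using int_partition_vanishes[OF assms(1)] by blast
  moreover obtain m' where "\<And>i. i \<ge> m' \<Longrightarrow> \<nu> i = 0"
    using int_partition_vanishes[OF assms(2)] by blast
  ultimately show ?thesis
    by (simp add: partition_size_eq_sum[of "max m m'"] sum.distrib)
qed

lemma young_boxes_eq:
  assumes "int_partition p"
  shows "young_boxes p = {(i, j). 1 \<le> j \<and> j \<le> p i}"
  using nonzero_part_iff[OF assms] by (fastforce simp: young_boxes_def)

lemma young_boxes_Sigma: "young_boxes p = (SIGMA i:{..<partition_length p}. {1..p i})"
  by (auto simp: young_boxes_def)

lemma finite_young_boxes [simp]: "finite (young_boxes p)"
  by (simp add: young_boxes_Sigma)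

lemma card_young_boxes:
  assumes "int_partition p"
  shows "card (young_boxes p) = partition_size p"
proof -
  have "card (young_boxes p) = sum p {..<partition_length p}"
    by (simp add: young_boxes_Sigma)
  also have "\<dots> = partition_size p"
    using nonzero_part_iff[OF assms] by (intro partition_size_eq_sum[symmetric]) (metis not_less)
  finally show ?thesis .
qed

lemma young_boxes_add_iff:
  assumes "int_partition \<mu>" "int_partition \<nu>"
  shows "(i, j) \<in> young_boxes (\<lambda>i. \<mu> i + \<nu> i) \<longleftrightarrow> 1 \<le> j \<and> j \<le> \<mu> i + \<nu> i"
  using assms by (simp add: young_boxes_eq int_partition_add)

text \<open>The truncated sum counts the boxes to the right of column \<open>h\<close>. Consecutive
  differences are therefore the column lengths, that is, the conjugate partition, which determines
  the rows. The ranks of the powers of \<open>x\<close> will supply exactly these sums.\<close>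

lemma partition_eq_of_truncated_sums:
  fixes p q :: "nat \<Rightarrow> nat"
  assumes p: "int_partition p" and q: "int_partition q"
    and sums: "\<And>h. (\<Sum>i<partition_length p. p i - h) = (\<Sum>i<partition_length q. q i - h)"
  shows "p = q"
proof -
  define M where "M = max (partition_length p) (partition_length q)"
  \<comment> \<open>The length of column \<open>h + 1\<close> of the diagram of \<open>r\<close>,
    cut off at the common length \<open>M\<close>.\<close>
  define N where "N r h = card {i \<in> {..<M}. h < r i}" for r :: "nat \<Rightarrow> nat" and h
  have extend: "(\<Sum>i<partition_length r. r i - h) = (\<Sum>i<M. r i - h)"
    if r: "int_partition r" "partition_length r \<le> M" for r h
  proof (intro sum.mono_neutral_left ballI)
    fix i assume "i \<in> {..<M} - {..<partition_length r}"
    then show "r i - h = 0"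
      using nonzero_part_iff[OF r(1), of i] by simp
  qed (use r(2) in auto)
  have step: "(\<Sum>i<M. r i - h) = (\<Sum>i<M. r i - Suc h) + N r h" for r :: "nat \<Rightarrow> nat" and h
  proof -
    have "N r h = (\<Sum>i<M. if h < r i then 1 else 0)"
      unfolding N_def by (simp add: sum.If_cases Int_def)
    moreover have "r i - h = (r i - Suc h) + (if h < r i then 1 else 0)" for i
      by auto
    ultimately show ?thesis
      by (simp only: sum.distrib[symmetric])
  qed
  have "(\<Sum>i<M. p i - h) = (\<Sum>i<M. q i - h)" for h
    using extend[OF p] extend[OF q] sums by (simp add: M_def)
  then have N: "N p h = N q h" for h
    using step[of p h] step[of q h] by simp
  \<comment> \<open>Compare the columns at height \<open>s i\<close>: if \<open>s i < r i\<close>,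
    then the rows \<open>0\<close> to \<open>i\<close> of \<open>r\<close> all exceed
    \<open>s i\<close>, while in \<open>s\<close> only rows before \<open>i\<close> can.\<close>
  have le: "r i \<le> s i"
    if r: "int_partition r" "partition_length r \<le> M" and s: "int_partition s"
      and N: "\<And>h. N r h = N s h" for r s i
  proof (rule ccontr)
    assume "\<not> r i \<le> s i"
    then have less: "s i < r i" by simp
    have anti: "antimono r" "antimono s"
      using r(1) s by (auto simp: int_partition_def)
    have "i < M"
      using less nonzero_part_iff[OF r(1), of i] r(2) by simp
    have "s i < r j" if "j \<le> i" for j
      using antimonoD[OF anti(1) that] less by simp
    then have "{..i} \<subseteq> {j \<in> {..<M}. s i < r j}"
      using \<open>i < M\<close> by auto
    from card_mono[OF _ this] have "Suc i \<le> N r (s i)"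
      by (simp add: N_def)
    have "j < i" if "s i < s j" for j
      using antimonoD[OF anti(2), of i j] that by (cases "i \<le> j") auto
    then have "{j \<in> {..<M}. s i < s j} \<subseteq> {..<i}"
      by auto
    from card_mono[OF _ this] have "N s (s i) \<le> i"
      by (simp add: N_def)
    with \<open>Suc i \<le> N r (s i)\<close> N[of "s i"] show False by simp
  qed
  show ?thesis
    using le[OF p _ q N] le[OF q _ p N[symmetric]] by (intro ext antisym) (simp_all add: M_def)
qed

section \<open>Existence of normal bases\<close>

context finite_dimensional_vector_space
begin

text \<open>An indexed form of linear dependence is needed because vectors with different indices
  may coincide; such a coincidence is itself a relation, with coefficients 1 and -1.\<close>

lemma dependent_family:
  assumes "finite I" "dim UNIV < card I"
  shows "\<exists>c. (\<Sum>p\<in>I. scale (c p) (f p)) = 0 \<and> (\<exists>p\<in>I. c p \<noteq> 0)"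
proof (cases "inj_on f I")
  case True
  then have "card (f ` I) = card I"
    by (rule card_image)
  then have "dependent (f ` I)"
    using assms independent_card_le_dim[of "f ` I" UNIV] by auto
  then obtain c where c: "\<exists>v\<in>f ` I. c v \<noteq> 0" "(\<Sum>v\<in>f ` I. scale (c v) v) = 0"
    using assms(1) by (auto simp: dependent_finite)
  with True have "(\<Sum>p\<in>I. scale ((c \<circ> f) p) (f p)) = 0"
    by (simp add: sum.reindex)
  with c(1) show ?thesis
    by (intro exI[of _ "c \<circ> f"]) auto
next
  case False
  then obtain p q where pq: "p \<in> I" "q \<in> I" "p \<noteq> q" "f p = f q"
    by (auto simp: inj_on_def)
  let ?c = "\<lambda>r. if r = p then 1 else if r = q then -1 else 0"
  have "(\<Sum>r\<in>I. scale (?c r) (f r)) = (\<Sum>r\<in>{p, q}. scale (?c r) (f r))"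
    using assms(1) pq by (intro sum.mono_neutral_right) auto
  also have "\<dots> = 0"
    using pq by simp
  finally show ?thesis
    using pq by (intro exI[of _ ?c]) auto
qed

end

lemma (in vector_space) linear_funpow:
  assumes "Vector_Spaces.linear scale scale f"
  shows "Vector_Spaces.linear scale scale (f ^^ k)"
proof (induction k)
  case 0
  show ?case by (simp only: funpow.simps linear_id)
next
  case (Suc k)
  then show ?case
    using Vector_Spaces.linear_compose[OF Suc assms] by (simp only: funpow.simps)
qed

section \<open>Submodules generated under a nilpotent endomorphism, and nilpotency orders\<close>

locale nilpotent_endomorphism = finite_dimensional_vector_space scale Basis
  for scale :: "'f::field \<Rightarrow> 'v::ab_group_add \<Rightarrow> 'v" (infixr \<open>*s\<close> 75)
    and Basis :: "'v set" +
  fixes x :: "'v \<Rightarrow> 'v"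
  assumes linear_x: "Vector_Spaces.linear scale scale x"
    and nilpotent_x: "\<exists>k. x ^^ k = (\<lambda>_. 0)"
begin

lemmas linear_pow = linear_funpow[OF linear_x]

interpretation pow: module_hom scale scale "x ^^ k" for k
  using linear_pow by (simp add: linear_iff_module_hom)

lemma pow_pow: "(x ^^ a) ((x ^^ b) u) = (x ^^ (a + b)) u"
  by (simp add: funpow_add)

lemma pow_pow': "x ((x ^^ b) u) = (x ^^ Suc b) u"
  by simp

lemma pow_eq_0_mono: "(x ^^ a) u = 0 \<Longrightarrow> a \<le> b \<Longrightarrow> (x ^^ b) u = 0"
  using pow_pow[of "b - a" a u] by simp

lemma pow_mem:
  assumes "x ` S \<subseteq> S" "u \<in> S"
  shows "(x ^^ k) u \<in> S"
  using assms by (induction k) auto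

text \<open>For V regarded as a module over the polynomial ring F[x], this is the submodule
  generated by \<open>U\<close>.\<close>

definition generated :: "'v set \<Rightarrow> 'v set" where
  "generated U = span {(x ^^ k) u | k u. u \<in> U}"

lemma subspace_generated [simp]: "subspace (generated U)"
  by (simp add: generated_def)

lemma pow_in_generated: "u \<in> U \<Longrightarrow> (x ^^ k) u \<in> generated U"
  unfolding generated_def by (rule span_base) blast

lemma generated_superset: "U \<subseteq> generated U"
  using pow_in_generated[of _ U 0] by auto

lemma generated_invariant: "x ` generated U \<subseteq> generated U"
proof -
  have "x ((x ^^ k) u) \<in> generated U" if "u \<in> U" for k u
    using pow_in_generated[OF that, of "Suc k"] by simp
  then have "{(x ^^ k) u | k u. u \<in> U} \<subseteq> {w. (x ^^ 1) w \<in> generated U}"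
    by auto
  then have "generated U \<subseteq> {w. (x ^^ 1) w \<in> generated U}"
    unfolding generated_def
    by (intro span_minimal pow.subspace_linear_preimage) (auto simp flip: generated_def)
  then show ?thesis by auto
qed

lemma generated_least:
  assumes "subspace S" "x ` S \<subseteq> S" "U \<subseteq> S"
  shows "generated U \<subseteq> S"
  unfolding generated_def using assms pow_mem[OF assms(2)] by (intro span_minimal) auto

lemma generated_eq_UNIV:
  assumes "generated U = UNIV" "U \<subseteq> generated U'"
  shows "generated U' = UNIV"
  using generated_least[OF subspace_generated generated_invariant assms(2)] assms(1) by auto

text \<open>This is Nakayama's lemma for the nilpotent \<open>x\<close>.\<close>

lemma mem_of_mod_radical:
  assumes S: "subspace S" "x ` S \<subseteq> S"
    and u: "u \<in> span (S \<union> range (\<lambda>k. (x ^^ Suc k) u))"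
  shows "u \<in> S"
proof -
  obtain N where N: "x ^^ N = (\<lambda>_. 0)"
    using nilpotent_x by blast
  \<comment> \<open>Downward induction on \<open>j\<close>, starting from \<open>N\<close> where the
    power vanishes. Applying \<open>x ^^ j\<close> to the relation for \<open>u\<close> leaves
    elements of \<open>S\<close> and powers of exponent above \<open>j\<close>, which are already
    known to lie in \<open>S\<close>.\<close>
  have "(x ^^ j) u \<in> S" if "N - m \<le> j" for m j
    using that
  proof (induction m arbitrary: j)
    case 0
    then have "(x ^^ j) u = 0"
      using pow_eq_0_mono[of N u j] N by simp
    then show ?case using S(1) subspace_0 by simp
  next
    case (Suc m)
    have "(x ^^ (j + Suc k)) u \<in> S" for k
      using Suc.prems by (intro Suc.IH) simp
    then have "S \<union> range (\<lambda>k. (x ^^ Suc k) u) \<subseteq> {y. (x ^^ j) y \<in> S}"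
      using pow_mem[OF S(2)] by (auto simp: pow_pow simp del: funpow.simps)
    then have "span (S \<union> range (\<lambda>k. (x ^^ Suc k) u)) \<subseteq> {y. (x ^^ j) y \<in> S}"
      using S(1) by (intro span_minimal pow.subspace_linear_preimage)
    then show ?case using u by auto
  qed
  from this[of N 0] show ?thesis by simp
qed

definition nil_order :: "'v \<Rightarrow> nat" where
  "nil_order u = (LEAST k. (x ^^ k) u = 0)"

lemma pow_nil_order: "(x ^^ nil_order u) u = 0"
proof -
  obtain N where "x ^^ N = (\<lambda>_. 0)"
    using nilpotent_x by blast
  then show ?thesis
    unfolding nil_order_def by (intro LeastI[where k = N and P = "\<lambda>k. (x ^^ k) u = 0"]) simp
qed

lemma nil_order_le: "(x ^^ k) u = 0 \<Longrightarrow> nil_order u \<le> k"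
  unfolding nil_order_def by (rule Least_le)

section \<open>Decomposition into cyclic modules\<close>

text \<open>Directness of the sum is encoded by the numerical bound: the vectors
  \<open>(x ^^ j) u\<close> with \<open>j < nil_order u\<close> span V, so once there are at most
  \<open>dim UNIV\<close> of them they form a basis.\<close>

lemma exists_small_generators:
  "\<exists>U. finite U \<and> generated U = UNIV \<and> sum nil_order U \<le> dim UNIV"
proof -
  let ?P = "\<lambda>U. finite U \<and> generated U = UNIV"
  have "?P Basis"
    using finite_Basis span_Basis span_minimal[OF generated_superset[of Basis]] by auto
  then obtain U where U: "finite U" "generated U = UNIV"
    and min: "\<And>U'. finite U' \<Longrightarrow> generated U' = UNIV \<Longrightarrow> sum nil_order U \<le> sum nil_order U'"
    using ex_has_least_nat[of ?P Basis "sum nil_order"] by metis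
  have "sum nil_order U \<le> dim UNIV"
  proof (rule ccontr)
    assume big: "\<not> sum nil_order U \<le> dim UNIV"
    let ?I = "SIGMA u:U. {..<nil_order u}"
    have "finite ?I" "dim UNIV < card ?I"
      using U(1) big by auto
    from dependent_family[OF this, of "\<lambda>(u, j). (x ^^ j) u"]
    obtain c where c0: "(\<Sum>p\<in>?I. c p *s (case p of (u, j) \<Rightarrow> (x ^^ j) u)) = 0"
      and ne: "\<exists>p\<in>?I. c p \<noteq> 0"
      by blast
    define J where "J = {p \<in> ?I. c p \<noteq> 0}"
    have J: "finite J" "J \<noteq> {}"
      using \<open>finite ?I\<close> ne by (auto simp: J_def)
    \<comment> \<open>Among the terms with nonzero coefficient, \<open>p\<close> has the lowest
      power of \<open>x\<close>.\<close>
    obtain p where p: "p \<in> J" "\<And>q. q \<in> J \<Longrightarrow> snd p \<le> snd q"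
      using ex_min_if_finite[of "snd ` J"] J by (auto simp: not_less)
    obtain u e where ue: "p = (u, e)" by force
    then have u: "u \<in> U" "e < nil_order u" "c (u, e) \<noteq> 0"
      using p(1) by (auto simp: J_def)
    \<comment> \<open>The relation divided by \<open>x ^^ e\<close>. It is killed by
      \<open>x ^^ e\<close> with \<open>e < nil_order u\<close>, and \<open>u\<close> itself occurs
      in it with the nonzero coefficient \<open>c (u, e)\<close>.\<close>
    define w where "w = (\<Sum>(t, j)\<in>J. c (t, j) *s (x ^^ (j - e)) t)"
    have "(x ^^ e) w = (\<Sum>(t, j)\<in>J. c (t, j) *s (x ^^ j) t)"
      unfolding w_def pow.sum using p(2) ue
      by (intro sum.cong refl) (auto simp: pow.scale pow_pow)
    also have "\<dots> = (\<Sum>(t, j)\<in>?I. c (t, j) *s (x ^^ j) t)"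
      unfolding J_def using \<open>finite ?I\<close> by (intro sum.mono_neutral_left) auto
    also have "\<dots> = 0"
      using c0 by (simp add: case_prod_beta)
    finally have ow: "nil_order w < nil_order u"
      using nil_order_le u(2) by (meson le_less_trans)
    define U' where "U' = insert w (U - {u})"
    \<comment> \<open>Up to a nonzero scalar, \<open>u\<close> equals \<open>w\<close> modulo the
      remaining generators and positive powers of \<open>x\<close> on \<open>u\<close>, so
      Nakayama's lemma applies.\<close>
    have "u \<in> generated U'"
    proof (rule mem_of_mod_radical)
      let ?S = "span (generated U' \<union> range (\<lambda>k. (x ^^ Suc k) u))"
      have base: "generated U' \<subseteq> ?S" "(x ^^ Suc k) u \<in> ?S" for k
        by (auto intro: span_base)
      have "w \<in> ?S"
        using base(1) generated_superset[of U'] by (auto simp: U'_def)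
      moreover have "c (t, j) *s (x ^^ (j - e)) t \<in> ?S" if "(t, j) \<in> J - {(u, e)}" for t j
      proof (cases "t = u")
        case True
        then have "e < j"
          using p(2)[of "(t, j)"] that ue by (cases "j = e") auto
        then have "j - e = Suc (j - e - 1)" by simp
        then show ?thesis
          using True base(2)[of "j - e - 1"] by (simp add: span_scale del: funpow.simps)
      next
        case False
        then have "t \<in> U'"
          using that by (auto simp: U'_def J_def)
        then show ?thesis
          using base(1) by (intro span_scale) (use pow_in_generated in blast)
      qed
      then have "(\<Sum>(t, j)\<in>J - {(u, e)}. c (t, j) *s (x ^^ (j - e)) t) \<in> ?S"
        by (intro span_sum) auto
      moreover have "w = c (u, e) *s u + (\<Sum>(t, j)\<in>J - {(u, e)}. c (t, j) *s (x ^^ (j - e)) t)"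
        unfolding w_def using J(1) p(1) ue by (subst sum.remove[of J "(u, e)"]) auto
      ultimately have "c (u, e) *s u \<in> ?S"
        by (simp only: span_add_eq2)
      from span_scale[OF this, of "inverse (c (u, e))"] show "u \<in> ?S"
        using u(3) by simp
    qed (use generated_invariant in auto)
    then have "U \<subseteq> generated U'"
      using generated_superset[of U'] by (auto simp: U'_def)
    then have "generated U' = UNIV"
      using U(2) by (rule generated_eq_UNIV[rotated])
    then have "sum nil_order U \<le> sum nil_order U'"
      using U(1) by (intro min) (auto simp: U'_def)
    \<comment> \<open>Only an inequality, since \<open>w\<close> may already belong to
      \<open>U - {u}\<close>.\<close>
    also have "\<dots> \<le> nil_order w + sum nil_order (U - {u})"
      unfolding U'_def using U(1) by (simp add: sum.insert_if)
    also have "\<dots> < nil_order u + sum nil_order (U - {u})"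
      using ow by simp
    also have "\<dots> = sum nil_order U"
      using U(1) u(1) by (simp add: sum.remove)
    finally show False by simp
  qed
  then show ?thesis using U by blast
qed

lemma exists_sorted_generators:
  "\<exists>u (l :: nat \<Rightarrow> nat) m. antimono l \<and> (\<forall>i\<ge>m. l i = 0) \<and> (\<forall>i. (x ^^ l i) (u i) = 0) \<and>
     generated (range u) = UNIV \<and> sum l {..<m} \<le> dim UNIV"
proof -
  obtain U where U: "finite U" "generated U = UNIV" "sum nil_order U \<le> dim UNIV"
    using exists_small_generators by blast
  obtain zs where zs: "set zs = U" "distinct zs"
    using finite_distinct_list[OF U(1)] by blast
  define us where "us = rev (sort_key nil_order zs)"
  have us: "set us = U" "distinct us" "sorted (rev (map nil_order us))"
    using zs by (auto simp: us_def rev_map)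
  \<comment> \<open>Padding with zero vectors, whose order is 0, gives a family on all of the
    natural numbers that keeps the orders nonincreasing.\<close>
  define u where "u i = (if i < length us then us ! i else 0)" for i
  have nil_order_0: "nil_order 0 = 0"
    using nil_order_le[of 0 0] by simp
  have 1: "antimono (\<lambda>i. nil_order (u i))"
  proof (rule antimonoI)
    fix i j :: nat
    assume "i \<le> j"
    then show "nil_order (u j) \<le> nil_order (u i)"
      using us(3) sorted_rev_nth_mono[of "map nil_order us" i j] by (auto simp: u_def nil_order_0)
  qed
  have 2: "\<forall>i\<ge>length us. nil_order (u i) = 0"
    by (simp add: u_def nil_order_0)
  have 3: "generated (range u) = UNIV"
  proof (rule generated_eq_UNIV[OF U(2)])
    have "U \<subseteq> range u"
      using us(1) by (force simp: u_def in_set_conv_nth)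
    then show "U \<subseteq> generated (range u)"
      using generated_superset by blast
  qed
  have 4: "(\<Sum>i<length us. nil_order (u i)) = sum nil_order U"
  proof -
    have "sum nil_order U = sum_list (map nil_order us)"
      using us by (simp add: sum_list_distinct_conv_sum_set)
    also have "\<dots> = (\<Sum>i<length us. nil_order (u i))"
      by (simp add: sum_list_sum_nth u_def atLeast0LessThan)
    finally show ?thesis ..
  qed
  show ?thesis
    by (rule exI[of _ u], rule exI[of _ "\<lambda>i. nil_order (u i)"], rule exI[of _ "length us"])
      (use 1 2 3 4 U(3) pow_nil_order in simp)
qed

section \<open>Adapting the generators to the vector v\<close>

text \<open>This splits off the constant term of the polynomial that is applied to
  \<open>u\<close>.\<close>

lemma generated_singleton_decomp:
  assumes "t \<in> generated {u}"
  shows "\<exists>c s. s \<in> generated {u} \<and> t = c *s u + x s"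
proof -
  interpret x: module_hom scale scale x
    using linear_x by (simp add: linear_iff_module_hom)
  let ?G = "generated {u}"
  let ?S = "{c *s u + x s | c s. s \<in> ?G}"
  have S: "c *s u + x s \<in> ?S" if "s \<in> ?G" for c s
    using that by blast
  have "generated {u} \<subseteq> ?S"
  proof (rule generated_least)
    show "subspace ?S"
    proof (rule subspaceI)
      show "0 \<in> ?S"
        using S[of 0 0] by (simp add: subspace_0)
    next
      fix a b assume "a \<in> ?S" "b \<in> ?S"
      then obtain c s c' s' where
        "a = c *s u + x s" "b = c' *s u + x s'" "s \<in> ?G" "s' \<in> ?G" by blast
      then show "a + b \<in> ?S"
        using S[of "s + s'" "c + c'"] by (simp add: subspace_add x.add scale_left_distrib ac_simps)
    next
      fix d a assume "a \<in> ?S"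
      then obtain c s where "a = c *s u + x s" "s \<in> ?G" by blast
      then show "d *s a \<in> ?S"
        using S[of "d *s s" "d * c"] by (simp add: subspace_scale x.scale scale_right_distrib)
    qed
    have mem: "c *s u + x s \<in> ?G" if "s \<in> ?G" for c s
      using that generated_superset[of "{u}"] generated_invariant[of "{u}"]
      by (intro subspace_add subspace_scale) auto
    show "x ` ?S \<subseteq> ?S"
    proof clarsimp
      fix c s assume "s \<in> ?G"
      from S[OF mem[OF this], of 0 c]
      show "\<exists>c' s'. x (c *s u + x s) = c' *s u + x s' \<and> s' \<in> ?G"
        by auto
    qed
    show "{u} \<subseteq> ?S"
      using S[of 0 1] by (simp add: subspace_0)
  qed
  then show ?thesis using assms by blast
qed

text \<open>In a cyclic module over F[x]/(x^l), a nonzero element is a power of \<open>x\<close>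
  times a unit times the generator; the unit is absorbed into a new generator
  \<open>u'\<close>.\<close>

lemma cyclic_factorization:
  assumes u: "(x ^^ l) u = 0" and w: "w \<in> generated {u}"
  shows "\<exists>k u'. k \<le> l \<and> w = (x ^^ k) u' \<and> (x ^^ l) u' = 0 \<and> u \<in> generated {u'}"
    (is "?goal")
proof -
  have ker: "generated {u} \<subseteq> {w. (x ^^ l) w = 0}"
    using u by (intro generated_least pow.subspace_kernel)
      (auto simp: funpow_swap1[symmetric] linear_x[unfolded linear_iff_module_hom, THEN module_hom.zero])
  \<comment> \<open>Pull out one factor \<open>x\<close> at a time. If the cofactor \<open>t\<close>
    has a nonzero constant term, it generates the same module and may serve as \<open>u'\<close>;
    otherwise another \<open>x\<close> comes out.\<close>
  have "?goal \<or> (\<exists>t\<in>generated {u}. w = (x ^^ d) t)" if "d \<le> l" for d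
    using that
  proof (induction d)
    case 0
    then show ?case using w by auto
  next
    case (Suc d)
    show ?case
    proof (cases ?goal)
      case False
      then obtain t where t: "t \<in> generated {u}" "w = (x ^^ d) t"
        using Suc by auto
      obtain c s where cs: "s \<in> generated {u}" "t = c *s u + x s"
        using generated_singleton_decomp[OF t(1)] by blast
      have "c = 0"
      proof (rule ccontr)
        assume c: "c \<noteq> 0"
        have "u \<in> generated {t}"
        proof (rule mem_of_mod_radical)
          let ?R = "span (generated {t} \<union> range (\<lambda>k. (x ^^ Suc k) u))"
          have "generated {u} \<subseteq> {s. (x ^^ 1) s \<in> ?R}"
            unfolding generated_def[of "{u}"]
            by (intro span_minimal pow.subspace_linear_preimage) (auto intro: span_base)
          then have "x s \<in> ?R"
            using cs(1) by auto
          moreover have "t \<in> ?R"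
            using generated_superset[of "{t}"] by (auto intro: span_base)
          ultimately have "c *s u \<in> ?R"
            using cs(2) by (simp only: span_add_eq2)
          from span_scale[OF this, of "inverse c"] show "u \<in> ?R"
            using c by simp
        qed (use generated_invariant in auto)
        moreover have "(x ^^ l) t = 0"
          using ker t(1) by auto
        ultimately show False
          using False t(2) Suc.prems by (metis Suc_leD)
      qed
      then have "w = (x ^^ Suc d) s"
        using t(2) cs(2) by (simp add: funpow_swap1)
      then show ?thesis using cs(1) by blast
    qed auto
  qed
  from this[of l] show ?thesis
  proof
    assume "\<exists>t\<in>generated {u}. w = (x ^^ l) t"
    \<comment> \<open>When all \<open>l\<close> factors come out, \<open>w\<close> vanishes and is
      represented with exponent \<open>l\<close>.\<close>
    then have "w = 0" using ker by auto
    then show ?thesis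
      using u generated_superset[of "{u}"] by (intro exI[of _ l] exI[of _ u]) auto
  qed auto
qed

lemma generated_sum:
  assumes "\<And>i. i \<ge> m \<Longrightarrow> u i = 0" "v \<in> generated (range u)"
  shows "\<exists>w. (\<forall>i. w i \<in> generated {u i}) \<and> v = (\<Sum>i<(m::nat). w i)"
proof -
  interpret x: module_hom scale scale x
    using linear_x by (simp add: linear_iff_module_hom)
  let ?S = "{\<Sum>i<m. w i | w. \<forall>i. w i \<in> generated {u i}}"
  have S: "(\<Sum>i<m. w i) \<in> ?S" if "\<And>i. w i \<in> generated {u i}" for w
    using that by blast
  have "generated (range u) \<subseteq> ?S"
  proof (rule generated_least)
    show "subspace ?S"
    proof (rule subspaceI)
      show "0 \<in> ?S"
        using S[of "\<lambda>_. 0"] by (simp add: subspace_0)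
    next
      fix a b assume "a \<in> ?S" "b \<in> ?S"
      then obtain w w' where "a = (\<Sum>i<m. w i)" "b = (\<Sum>i<m. w' i)"
        "\<forall>i. w i \<in> generated {u i}" "\<forall>i. w' i \<in> generated {u i}" by blast
      then show "a + b \<in> ?S"
        using S[of "\<lambda>i. w i + w' i"] by (simp add: subspace_add sum.distrib)
    next
      fix d a assume "a \<in> ?S"
      then obtain w where "a = (\<Sum>i<m. w i)" "\<forall>i. w i \<in> generated {u i}" by blast
      then show "d *s a \<in> ?S"
        using S[of "\<lambda>i. d *s w i"] by (simp add: subspace_scale scale_sum_right)
    qed
    show "x ` ?S \<subseteq> ?S"
    proof
      fix a assume "a \<in> x ` ?S"
      then obtain w where w: "a = x (\<Sum>i<m. w i)" "\<forall>i. w i \<in> generated {u i}" by blast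
      then show "a \<in> ?S"
        using S[of "\<lambda>i. x (w i)"] generated_invariant by (simp add: x.sum image_subset_iff)
    qed
    show "range u \<subseteq> ?S"
    proof
      fix a assume "a \<in> range u"
      then obtain j where j: "a = u j" by blast
      have "u i \<in> generated {u i}" for i
        using generated_superset[of "{u i}"] by simp
      then have "(if i = j then u i else 0) \<in> generated {u i}" for i
        by (simp add: subspace_0)
      from S[OF this] have "(if j < m then u j else 0) \<in> ?S"
        by simp
      then show "a \<in> ?S"
        unfolding j using assms(1)[of j] by (cases "j < m") (simp_all only: if_True if_False not_less)
    qed
  qed
  then show ?thesis using assms(2) by blast
qed

text \<open>Here \<open>l i\<close> only bounds the order of \<open>u i\<close>, so changing a
  generator requires checking annihilation and generation alone. The condition
  \<open>k i \<le> l i\<close> makes \<open>l i - k i\<close> a true difference, the future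
  \<mu>.\<close>

definition adapted_generators ::
    "'v \<Rightarrow> nat \<Rightarrow> (nat \<Rightarrow> nat) \<Rightarrow> (nat \<Rightarrow> 'v) \<Rightarrow> (nat \<Rightarrow> nat) \<Rightarrow> bool" where
  "adapted_generators v m l u k \<longleftrightarrow>
     (\<forall>i. k i \<le> l i) \<and> (\<forall>i. (x ^^ l i) (u i) = 0) \<and> generated (range u) = UNIV \<and>
     v = (\<Sum>i<m. (x ^^ k i) (u i))"

lemma exists_adapted_generators:
  assumes m: "\<And>i. i \<ge> m \<Longrightarrow> l i = 0"
    and u: "\<And>i. (x ^^ l i) (u i) = 0" "generated (range u) = UNIV"
  shows "\<exists>u k. adapted_generators v m l u k"
proof -
  have "u i = 0" if "i \<ge> m" for i
    using u(1)[of i] m[OF that] by simp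
  then have "\<exists>w. (\<forall>i. w i \<in> generated {u i}) \<and> v = (\<Sum>i<m. w i)"
    using u(2) by (intro generated_sum) auto
  then obtain w where w: "\<And>i. w i \<in> generated {u i}" "v = (\<Sum>i<m. w i)"
    by blast
  from cyclic_factorization[OF u(1) w(1)]
  obtain k u' where k: "\<And>i. k i \<le> l i" "\<And>i. w i = (x ^^ k i) (u' i)"
      "\<And>i. (x ^^ l i) (u' i) = 0" "\<And>i. u i \<in> generated {u' i}"
    by metis
  have "generated {u' i} \<subseteq> generated (range u')" for i
    using generated_superset[of "range u'"]
    by (intro generated_least generated_invariant) auto
  then have "range u \<subseteq> generated (range u')"
    using k(4) by blast
  then have "generated (range u') = UNIV"
    by (rule generated_eq_UNIV[OF u(2)])
  then have "adapted_generators v m l u' k"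
    unfolding adapted_generators_def using k w(2) by simp
  then show ?thesis by blast
qed

text \<open>
  If the pairs \<open>(l i - k i, k i)\<close> and \<open>(l j - k j, k j)\<close> are incomparable, then \<open>k i\<close> can be
  lowered by one: the error in the summand of row \<open>i\<close> is absorbed by the generator of row \<open>j\<close>.
\<close>

lemma adapted_generators_reduce:
  assumes ad: "adapted_generators v m l u k"
    and ij: "i < m" "j < m" and less: "l i - k i < l j - k j" "k j < k i"
  shows "\<exists>u'. adapted_generators v m l u' (k(i := k i - 1))"
proof -
  \<comment> \<open>Chosen so that \<open>k j + Suc d = k i\<close>. Then
    \<open>(x ^^ k j) r\<close> is exactly the change in summand \<open>i\<close> when its exponent
    drops by one, and adding \<open>r\<close> to \<open>u j\<close> compensates for it.\<close>
  define d where "d = k i - 1 - k j"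
  define r where "r = (x ^^ Suc d) (u i) - (x ^^ d) (u i)"
  define u' where "u' = u(j := u j + r)"
  have k: "\<And>i. k i \<le> l i" and u: "\<And>i. (x ^^ l i) (u i) = 0" "generated (range u) = UNIV"
    and v: "v = (\<Sum>i<m. (x ^^ k i) (u i))"
    using ad by (auto simp: adapted_generators_def)
  have "i \<noteq> j" using less by auto
  \<comment> \<open>The inequality between the \<open>l - k\<close> values is what ensures that
    \<open>x ^^ l j\<close> still kills the new generator of row \<open>j\<close>.\<close>
  have "l i \<le> l j + d"
    using less k[of i] k[of j] by (simp add: d_def)
  then have "(x ^^ l j) r = 0"
    unfolding r_def pow.diff pow_pow using u(1)[of i]
    by (simp add: pow_eq_0_mono[of "l i" "u i"] del: funpow.simps)
  then have "(x ^^ l a) (u' a) = 0" for a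
    using u(1) by (simp add: u'_def pow.add)
  moreover have "generated (range u') = UNIV"
  proof (rule generated_eq_UNIV[OF u(2)])
    have mem: "u' a \<in> generated (range u')" for a
      using generated_superset[of "range u'"] by auto
    \<comment> \<open>Row \<open>i\<close> is unchanged, so \<open>r\<close>, built from
      \<open>u i\<close> alone, stays available and the old \<open>u j\<close> can be
      recovered.\<close>
    then have "u i \<in> generated (range u')"
      using \<open>i \<noteq> j\<close> by (metis u'_def fun_upd_other)
    then have "r \<in> generated (range u')"
      unfolding r_def by (intro subspace_diff pow_mem generated_invariant) auto
    then have "u' j - r \<in> generated (range u')"
      using mem by (intro subspace_diff) auto
    then have "u a \<in> generated (range u')" for a
      using mem[of a] by (cases "a = j") (auto simp: u'_def)
    then show "range u \<subseteq> generated (range u')" by auto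
  qed
  moreover have "v = (\<Sum>a<m. (x ^^ (k(i := k i - 1)) a) (u' a))"
  proof -
    have split: "(\<Sum>a<m. f a) = f i + (f j + (\<Sum>a\<in>{..<m} - {i} - {j}. f a))" for f :: "nat \<Rightarrow> 'v"
      using ij \<open>i \<noteq> j\<close> by (subst sum.remove[of _ i], simp, simp, subst sum.remove[of _ j]) auto
    have e: "k j + Suc d = k i" "k j + d = k i - 1"
      using less by (auto simp: d_def)
    have "(x ^^ k j) r = (x ^^ k i) (u i) - (x ^^ (k i - 1)) (u i)"
      unfolding r_def pow.diff pow_pow e ..
    then have "(x ^^ (k i - 1)) (u i) + (x ^^ k j) (u' j) = (x ^^ k i) (u i) + (x ^^ k j) (u j)"
      by (simp add: u'_def pow.add)
    then show ?thesis
      unfolding v split using \<open>i \<noteq> j\<close> by (simp add: u'_def flip: add.assoc)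
  qed
  ultimately have "adapted_generators v m l u' (k(i := k i - 1))"
    unfolding adapted_generators_def using k by (simp add: le_diff_conv le_SucI)
  then show ?thesis by blast
qed

lemma exists_normal_generators:
  "\<exists>u \<mu> \<nu> (m :: nat). antimono \<mu> \<and> antimono \<nu> \<and> (\<forall>i\<ge>m. \<mu> i = 0 \<and> \<nu> i = 0) \<and>
     (\<forall>i. (x ^^ (\<mu> i + \<nu> i)) (u i) = 0) \<and> generated (range u) = UNIV \<and>
     (\<Sum>i<m. \<mu> i + \<nu> i) \<le> dim UNIV \<and> v = (\<Sum>i<m. (x ^^ \<nu> i) (u i))"
proof -
  obtain u0 l and m :: nat where l: "antimono l" "\<And>i. i \<ge> m \<Longrightarrow> l i = 0" "sum l {..<m} \<le> dim UNIV"
    and u0: "\<And>i. (x ^^ l i) (u0 i) = 0" "generated (range u0) = UNIV"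
    using exists_sorted_generators by blast
  let ?P = "\<lambda>k. \<exists>u. adapted_generators v m l u k"
  obtain k0 where "?P k0"
    using exists_adapted_generators[OF l(2) u0] by blast
  then obtain k where "?P k" and min: "\<And>k'. ?P k' \<Longrightarrow> sum k {..<m} \<le> sum k' {..<m}"
    using ex_has_least_nat[of ?P k0 "\<lambda>k. sum k {..<m}"] by blast
  then obtain u where u: "adapted_generators v m l u k" by blast
  then have k: "k i \<le> l i" for i
    by (simp add: adapted_generators_def)
  have chain: "l j - k j \<le> l i - k i \<or> k i \<le> k j" if "i < m" "j < m" for i j
  proof (rule ccontr)
    assume c: "\<not> ?thesis"
    then have "?P (k(i := k i - 1))"
      using adapted_generators_reduce[OF u that] by simp
    then have "sum k {..<m} \<le> sum (k(i := k i - 1)) {..<m}"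
      by (rule min)
    \<comment> \<open>Failure of the chain condition gives \<open>k j < k i\<close>, so
      \<open>k i\<close> is positive and the truncated decrement is strict.\<close>
    also have "\<dots> < sum k {..<m}"
      using that c by (intro sum_strict_mono_ex1) auto
    finally show False by simp
  qed
  \<comment> \<open>A violation in one coordinate forces, by the chain condition, a weak inequality
    in the same direction in the other. Adding the two gives \<open>l i < l j\<close>, against the
    sorting of \<open>l\<close>.\<close>
  have anti: "l j - k j \<le> l i - k i \<and> k j \<le> k i" if "i \<le> j" for i j
  proof (cases "j < m")
    case True
    have "l j \<le> l i"
      using l(1) that by (rule antimonoD)
    then show ?thesis
      using chain[of i j] chain[of j i] True that k[of i] k[of j] by linarith
  qed (use l(2) k[of j] in auto)
  show ?thesis
    by (rule exI[of _ u], rule exI[of _ "\<lambda>i. l i - k i"], rule exI[of _ k], rule exI[of _ m])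
      (use u k l anti in \<open>auto simp: adapted_generators_def intro!: antimonoI, metis le_zero_eq\<close>)
qed

section \<open>From generators to normal bases\<close>

text \<open>One count settles the basis property: the family spans, so \<open>dim UNIV\<close> is at
  most the number of distinct vectors, at most the number of boxes, at most \<open>dim UNIV\<close>.
  Equality throughout gives injectivity and independence. The generator of a row sits at its right
  end.\<close>

lemma is_jordan_basis_if_generated:
  assumes l: "int_partition l" "partition_size l \<le> dim UNIV"
    and u: "\<And>i. (x ^^ l i) (u i) = 0" "generated (range u) = UNIV"
  shows "is_jordan_basis scale x l (\<lambda>i j. (x ^^ (l i - j)) (u i))"
proof -
  let ?b = "\<lambda>(i, j). (x ^^ (l i - j)) (u i)"
  let ?D = "young_boxes l"
  have "(x ^^ k) (u i) \<in> span (?b ` ?D)" for k i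
  proof (cases "k < l i")
    case True
    then have "(i, l i - k) \<in> ?D" "l i - (l i - k) = k"
      using l(1) by (auto simp: young_boxes_eq)
    then show ?thesis
      by (intro span_base) force
  next
    case False
    then show ?thesis
      using pow_eq_0_mono[OF u(1)] by (simp add: span_zero)
  qed
  then have "generated (range u) \<subseteq> span (?b ` ?D)"
    unfolding generated_def by (intro span_minimal) auto
  then have span: "span (?b ` ?D) = UNIV"
    using u(2) by auto
  have "dim UNIV \<le> card (?b ` ?D)"
    using span by (intro span_card_ge_dim) auto
  moreover have "card (?b ` ?D) \<le> card ?D"
    by (rule card_image_le) simp
  moreover have "card ?D \<le> dim UNIV"
    using l by (simp add: card_young_boxes)
  ultimately have "card (?b ` ?D) = card ?D" "card (?b ` ?D) \<le> dim UNIV"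
    by auto
  then have "inj_on ?b ?D" "independent (?b ` ?D)"
    using span card_le_dim_spanning[of "?b ` ?D" UNIV] by (simp_all add: eq_card_imp_inj_on del: dim_UNIV)
  moreover have "x ((x ^^ (l i - j)) (u i)) = (if j > 1 then (x ^^ (l i - (j - 1))) (u i) else 0)"
    if "(i, j) \<in> ?D" for i j
  proof -
    have "1 \<le> j" "j \<le> l i" using that by (auto simp: young_boxes_def)
    then have "Suc (l i - j) = l i - (j - 1)" by simp
    then have "x ((x ^^ (l i - j)) (u i)) = (x ^^ (l i - (j - 1))) (u i)"
      by (metis pow_pow')
    then show ?thesis
      using u(1)[of i] \<open>1 \<le> j\<close> by (cases "j = 1") auto
  qed
  ultimately show ?thesis
    unfolding is_jordan_basis_def using l(1) span by auto
qed

lemma exists_normal_basis: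
  "\<exists>\<mu> \<nu> b. (\<mu>, \<nu>) \<in> bipartitions (dim UNIV) \<and> is_normal_basis scale v x \<mu> \<nu> b"
proof -
  obtain u \<mu> \<nu> and m :: nat where anti: "antimono \<mu>" "antimono \<nu>"
    and m: "\<And>i. i \<ge> m \<Longrightarrow> \<mu> i = 0" "\<And>i. i \<ge> m \<Longrightarrow> \<nu> i = 0"
    and u: "\<And>i. (x ^^ (\<mu> i + \<nu> i)) (u i) = 0" "generated (range u) = UNIV"
    and size: "(\<Sum>i<m. \<mu> i + \<nu> i) \<le> dim UNIV" and v: "v = (\<Sum>i<m. (x ^^ \<nu> i) (u i))"
    using exists_normal_generators[of v] by blast
  let ?l = "\<lambda>i. \<mu> i + \<nu> i"
  let ?b = "\<lambda>i j. (x ^^ (?l i - j)) (u i)"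
  have part: "int_partition \<mu>" "int_partition \<nu>"
    using anti m by (auto intro: int_partitionI[of _ m])
  have "partition_size ?l \<le> dim UNIV"
    using size m by (subst partition_size_eq_sum[of m]) auto
  with part u have jb: "is_jordan_basis scale x ?l ?b"
    by (intro is_jordan_basis_if_generated int_partition_add)
  \<comment> \<open>Position \<open>\<mu> i\<close> of row \<open>i\<close> carries the exponent
    \<open>\<nu> i\<close>.\<close>
  have "v = (\<Sum>i<m. ?b i (\<mu> i))"
    by (simp add: v)
  also have "\<dots> = (\<Sum>i<partition_length \<mu>. ?b i (\<mu> i))"
  proof (intro sum.mono_neutral_right ballI)
    fix i assume "i \<in> {..<m} - {..<partition_length \<mu>}"
    \<comment> \<open>Position 0 lies outside the diagram, but the formula for \<open>?b\<close>
      still gives a value there, namely \<open>(x ^^ ?l i) (u i)\<close>, which is zero.\<close>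
    then have "\<mu> i = 0"
      using nonzero_part_iff[OF part(1), of i] by auto
    then show "?b i (\<mu> i) = 0"
      using u(1)[of i] by simp
  qed (use partition_length_le[OF part(1) m(1)] in auto)
  finally have nb: "is_normal_basis scale v x \<mu> \<nu> ?b"
    unfolding is_normal_basis_def using part jb by simp
  have "partition_size \<mu> + partition_size \<nu> = card (young_boxes ?l)"
    using part by (simp add: card_young_boxes int_partition_add partition_size_add)
  also have "\<dots> = dim UNIV"
    using jb dim_span_eq_card_independent[of "(\<lambda>(i, j). ?b i j) ` young_boxes ?l"]
    unfolding is_jordan_basis_def by (simp add: card_image del: dim_UNIV)
  finally have "(\<mu>, \<nu>) \<in> bipartitions (dim UNIV)"
    using part by (simp add: bipartitions_def)
  then show ?thesis using nb by blast
qed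

end

section \<open>Uniqueness of the type\<close>

text \<open>Each application of \<open>x\<close> shifts a row one step to the left. Nilpotency is
  not presupposed, so the lemma can also be used to establish it in
  \<open>exists_of_type\<close>.\<close>

lemma jordan_basis_funpow:
  assumes "is_jordan_basis scale x l b" "x 0 = 0" "1 \<le> j" "j \<le> l i"
  shows "(x ^^ h) (b i j) = (if h < j then b i (j - h) else 0)"
proof (induction h)
  case 0
  then show ?case using assms(3) by simp
next
  case (Suc h)
  have l: "int_partition l" and step: "\<forall>(i, j) \<in> young_boxes l. x (b i j) = (if j > 1 then b i (j - 1) else 0)"
    using assms(1) by (auto simp: is_jordan_basis_def)
  show ?case
  proof (cases "h < j")
    case True
    then have "(i, j - h) \<in> young_boxes l"
      using assms(4) l by (auto simp: young_boxes_eq)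
    with step have "x (b i (j - h)) = (if j - h > 1 then b i (j - h - 1) else 0)"
      by blast
    then show ?thesis
      using Suc True by auto
  qed (use Suc assms(2) in simp)
qed

context nilpotent_endomorphism
begin

interpretation pow: module_hom scale scale "x ^^ k" for k
  using linear_pow by (simp add: linear_iff_module_hom)

lemma x_zero [simp]: "x 0 = 0"
  using pow.zero[of 1] by simp

text \<open>A box survives as the image of another under \<open>x ^^ h\<close> exactly when at least
  \<open>h\<close> boxes of its row lie to its right.\<close>

lemma range_pow_jordan_basis:
  assumes jb: "is_jordan_basis scale x l b"
  shows "range (x ^^ h) = span ((\<lambda>(i, j). b i j) ` {(i, j). 1 \<le> j \<and> j + h \<le> l i})"
    (is "_ = span (?b ` ?D)")
proof -
  have l: "int_partition l" and sp: "span (?b ` young_boxes l) = UNIV"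
    using jb by (auto simp: is_jordan_basis_def)
  have "range (x ^^ h) = span ((x ^^ h) ` ?b ` young_boxes l)"
    using pow.span_image[of h "?b ` young_boxes l"] sp by simp
  also have "\<dots> = span (?b ` ?D)"
  proof (unfold span_eq, intro conjI subsetI)
    fix y assume "y \<in> (x ^^ h) ` ?b ` young_boxes l"
    then obtain i j where ij: "1 \<le> j" "j \<le> l i" "y = (x ^^ h) (b i j)"
      using l by (auto simp: young_boxes_eq)
    then show "y \<in> span (?b ` ?D)"
      using jordan_basis_funpow[OF jb x_zero ij(1,2), of h]
      by (auto simp: span_zero intro!: span_base image_eqI[of _ _ "(i, j - h)"])
  next
    fix y assume "y \<in> ?b ` ?D"
    then obtain i j where ij: "1 \<le> j" "j + h \<le> l i" "y = b i j"
      by auto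
    then have "y = (x ^^ h) (b i (j + h))"
      using jordan_basis_funpow[OF jb x_zero, of "j + h" i h] by simp
    then have "y \<in> (x ^^ h) ` ?b ` young_boxes l"
      using ij l by (auto simp: young_boxes_eq intro!: imageI image_eqI[of _ _ "(i, j + h)"])
    then show "y \<in> span ((x ^^ h) ` ?b ` young_boxes l)"
      by (rule span_base)
  qed
  finally show ?thesis .
qed

lemma dim_range_pow_jordan_basis:
  assumes jb: "is_jordan_basis scale x l b"
  shows "dim (range (x ^^ h)) = (\<Sum>i<partition_length l. l i - h)"
proof -
  let ?b = "\<lambda>(i, j). b i j" and ?D = "{(i, j). 1 \<le> j \<and> j + h \<le> l i}"
  have l: "int_partition l" and ind: "independent (?b ` young_boxes l)" "inj_on ?b (young_boxes l)"
    using jb by (auto simp: is_jordan_basis_def)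
  have sub: "?D \<subseteq> young_boxes l"
    using l by (auto simp: young_boxes_eq)
  then have "independent (?b ` ?D)" "inj_on ?b ?D"
    using independent_mono[OF ind(1) image_mono] inj_on_subset[OF ind(2)] by blast+
  then have "dim (range (x ^^ h)) = card ?D"
    by (simp add: range_pow_jordan_basis[OF jb] dim_span_eq_card_independent card_image del: dim_span)
  also have "?D = (SIGMA i:{..<partition_length l}. {1..l i - h})"
    using nonzero_part_iff[OF l] by fastforce
  finally show ?thesis by simp
qed

text \<open>The ranks of the powers of \<open>x\<close> do not depend on a basis, and they are the
  truncated sums of the Jordan type.\<close>

lemma jordan_type_unique:
  assumes "is_jordan_basis scale x l b" "is_jordan_basis scale x l' b'"
  shows "l = l'"
proof (rule partition_eq_of_truncated_sums)
  show "(\<Sum>i<partition_length l. l i - h) = (\<Sum>i<partition_length l'. l' i - h)" for h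
    by (simp only: dim_range_pow_jordan_basis[OF assms(1), symmetric]
        dim_range_pow_jordan_basis[OF assms(2), symmetric])
qed (use assms in \<open>auto simp: is_jordan_basis_def\<close>)

text \<open>
  The pairs \<open>(\<mu> i, \<nu> i)\<close> form a chain, and \<open>v \<in> ker x\<^sup>k + im x\<^sup>h\<close> holds iff every \<open>i\<close> has
  \<open>\<mu> i \<le> k\<close> or \<open>h \<le> \<nu> i\<close>. If \<open>\<mu>' i < \<mu> i\<close>, the two types disagree at \<open>k = \<mu>' i\<close>, \<open>h = \<nu>' i\<close>.
\<close>

lemma normal_type_le:
  assumes nb: "is_normal_basis scale v x \<mu> \<nu> b" and nb': "is_normal_basis scale v x \<mu>' \<nu>' b'"
    and sum_eq: "\<And>i. \<mu> i + \<nu> i = \<mu>' i + \<nu>' i"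
  shows "\<mu> i \<le> \<mu>' i"
proof (rule ccontr)
  assume "\<not> \<mu> i \<le> \<mu>' i"
  define k where "k = \<mu>' i"
  define h where "h = \<nu>' i"
  have less: "k < \<mu> i" "\<nu> i < h"
    using \<open>\<not> \<mu> i \<le> \<mu>' i\<close> sum_eq[of i] by (auto simp: k_def h_def)
  let ?l = "\<lambda>i. \<mu> i + \<nu> i" and ?l' = "\<lambda>i. \<mu>' i + \<nu>' i" and ?b = "\<lambda>(i, j). b i j"
  let ?M = "{..<partition_length \<mu>}" and ?M' = "{..<partition_length \<mu>'}"
  have part: "int_partition \<mu>" "int_partition \<nu>" and jb: "is_jordan_basis scale x ?l b"
    and v: "v = (\<Sum>j\<in>?M. b j (\<mu> j))"
    using nb by (auto simp: is_normal_basis_def)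
  have part': "int_partition \<mu>'" "int_partition \<nu>'" and jb': "is_jordan_basis scale x ?l' b'"
    and v': "v = (\<Sum>j\<in>?M'. b' j (\<mu>' j))"
    using nb' by (auto simp: is_normal_basis_def)
  have anti': "antimono \<mu>'" "antimono \<nu>'"
    using part' by (auto simp: int_partition_def)
  have pos: "1 \<le> \<mu> j" if "j \<in> ?M" for j
    using nonzero_part_iff[OF part(1), of j] that by simp
  have pos': "1 \<le> \<mu>' j" if "j \<in> ?M'" for j
    using nonzero_part_iff[OF part'(1), of j] that by simp
  \<comment> \<open>In rows before \<open>i\<close> the box \<open>\<mu>' j + h\<close> exists,
    because \<open>h = \<nu>' i \<le> \<nu>' j\<close>, and \<open>x ^^ h\<close> moves it to
    \<open>\<mu>' j\<close>. The other rows of \<open>v\<close> are killed by \<open>x ^^ k\<close>,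
    so \<open>w\<close> witnesses that \<open>(x ^^ k) v\<close> lies in the image of
    \<open>x ^^ (k + h)\<close>.\<close>
  define w where "w = (\<Sum>j\<in>?M' \<inter> {..<i}. b' j (\<mu>' j + h))"
  have "(x ^^ (k + h)) w = (\<Sum>j\<in>?M' \<inter> {..<i}. (x ^^ k) (b' j (\<mu>' j)))"
    unfolding w_def pow.sum
  proof (intro sum.cong refl)
    fix j assume j: "j \<in> ?M' \<inter> {..<i}"
    then have "h \<le> \<nu>' j"
      using antimonoD[OF anti'(2), of j i] by (simp add: h_def)
    then have "(x ^^ h) (b' j (\<mu>' j + h)) = b' j (\<mu>' j)"
      using jordan_basis_funpow[OF jb' x_zero, of "\<mu>' j + h" j h] pos'[of j] j by simp
    then show "(x ^^ (k + h)) (b' j (\<mu>' j + h)) = (x ^^ k) (b' j (\<mu>' j))"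
      by (simp add: funpow_add)
  qed
  also have "\<dots> = (\<Sum>j\<in>?M'. (x ^^ k) (b' j (\<mu>' j)))"
  proof (intro sum.mono_neutral_left ballI)
    fix j assume j: "j \<in> ?M' - ?M' \<inter> {..<i}"
    then have "\<mu>' j \<le> k"
      using antimonoD[OF anti'(1), of i j] by (auto simp: k_def)
    then show "(x ^^ k) (b' j (\<mu>' j)) = 0"
      using jordan_basis_funpow[OF jb' x_zero, of "\<mu>' j" j k] pos'[of j] j by simp
  qed auto
  also have "\<dots> = (x ^^ k) v"
    by (simp add: v' pow.sum)
  finally have kv: "(x ^^ k) v = (x ^^ (k + h)) w" ..
  \<comment> \<open>In the first basis \<open>(x ^^ k) v\<close> has coefficient 1 at this box. The
    image of \<open>x ^^ (k + h)\<close> avoids it, since \<open>\<mu> i + h\<close> exceeds the row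
    length \<open>\<mu> i + \<nu> i\<close>.\<close>
  let ?p = "(i, \<mu> i - k)"
  let ?S = "span (?b ` (young_boxes ?l - {?p}))"
  have inj: "inj_on ?b (young_boxes ?l)" and ind: "independent (?b ` young_boxes ?l)"
    using jb by (auto simp: is_jordan_basis_def)
  have pD: "?p \<in> young_boxes ?l"
    using less(1) part by (auto simp: young_boxes_add_iff)
  have iM: "i \<in> ?M"
    using less nonzero_part_iff[OF part(1), of i] by simp
  have pow_b: "(x ^^ k) (b j (\<mu> j)) = (if k < \<mu> j then b j (\<mu> j - k) else 0)" if "j \<in> ?M" for j
    using jordan_basis_funpow[OF jb x_zero, of "\<mu> j" j k] pos[OF that] by simp
  have others: "(\<Sum>j\<in>?M - {i}. (x ^^ k) (b j (\<mu> j))) \<in> ?S"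
  proof (intro span_sum)
    fix j assume j: "j \<in> ?M - {i}"
    show "(x ^^ k) (b j (\<mu> j)) \<in> ?S"
    proof (cases "k < \<mu> j")
      case True
      then have "(j, \<mu> j - k) \<in> young_boxes ?l - {?p}"
        using j part by (auto simp: young_boxes_add_iff)
      then show ?thesis
        using True j pow_b[of j] by (auto intro!: span_base image_eqI[of _ _ "(j, \<mu> j - k)"])
    qed (use j pow_b[of j] in \<open>auto simp: span_zero\<close>)
  qed
  have "(x ^^ (k + h)) w \<in> span (?b ` {(i, j). 1 \<le> j \<and> j + (k + h) \<le> ?l i})"
    using range_pow_jordan_basis[OF jb, of "k + h"] by blast
  also have "\<dots> \<subseteq> ?S"
    using less part by (intro span_mono image_mono) (auto simp: young_boxes_add_iff)
  finally have "(x ^^ k) v \<in> ?S"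
    by (simp only: kv)
  also have "(x ^^ k) v = b i (\<mu> i - k) + (\<Sum>j\<in>?M - {i}. (x ^^ k) (b j (\<mu> j)))"
    unfolding v pow.sum using iM less(1) pow_b[OF iM] by (subst sum.remove[of _ i]) auto
  \<comment> \<open>Subtracting the other rows puts a basis vector in the span of the remaining
    ones, contradicting independence.\<close>
  finally have "b i (\<mu> i - k) \<in> ?S"
    using others by (simp only: span_add_eq2)
  moreover have "?b ` (young_boxes ?l - {?p}) = ?b ` young_boxes ?l - {b i (\<mu> i - k)}"
    using inj_on_image_set_diff[OF inj, of "young_boxes ?l" "{?p}"] pD by simp
  ultimately have "b i (\<mu> i - k) \<in> span (?b ` young_boxes ?l - {b i (\<mu> i - k)})"
    by (simp only:)
  moreover have "b i (\<mu> i - k) \<in> ?b ` young_boxes ?l"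
    using imageI[OF pD, of ?b] by (simp only: prod.case)
  ultimately have "dependent (?b ` young_boxes ?l)"
    unfolding dependent_def by (rule bexI)
  then show False using ind by simp
qed

lemma normal_type_unique:
  assumes nb: "is_normal_basis scale v x \<mu> \<nu> b" and nb': "is_normal_basis scale v x \<mu>' \<nu>' b'"
  shows "\<mu> = \<mu>'" "\<nu> = \<nu>'"
proof -
  have "(\<lambda>i. \<mu> i + \<nu> i) = (\<lambda>i. \<mu>' i + \<nu>' i)"
    using nb nb' by (intro jordan_type_unique) (auto simp: is_normal_basis_def)
  then have eq: "\<mu> i + \<nu> i = \<mu>' i + \<nu>' i" for i
    by (rule fun_cong)
  show "\<mu> = \<mu>'"
    using normal_type_le[OF nb nb' eq] normal_type_le[OF nb' nb eq[symmetric]]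
    by (intro ext antisym)
  then show "\<nu> = \<nu>'"
    using eq by auto
qed

end

section \<open>Orbits\<close>

context finite_dimensional_vector_space
begin

lemma linear_GL: "g \<in> carrier (GL_group scale) \<Longrightarrow> Vector_Spaces.linear scale scale g"
  by (simp add: GL_group_def)

lemma normal_basis_conjugate:
  assumes g: "g \<in> carrier (GL_group scale)" and nb: "is_normal_basis scale v x \<mu> \<nu> b"
  shows "is_normal_basis scale (g v) (g \<circ> x \<circ> inv_into UNIV g) \<mu> \<nu> (\<lambda>i j. g (b i j))"
proof -
  interpret g: module_hom scale scale g
    using linear_GL[OF g] by (simp add: linear_iff_module_hom)
  have bij: "bij g" using g by (simp add: GL_group_def)
  then have inj: "inj g" and surj: "surj g"
    by (auto simp: bij_def)
  let ?b = "\<lambda>(i, j). b i j" and ?D = "young_boxes (\<lambda>i. \<mu> i + \<nu> i)"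
  have im: "(\<lambda>(i, j). g (b i j)) ` ?D = g ` ?b ` ?D"
    by (auto simp: image_image case_prod_beta)
  have jb: "int_partition (\<lambda>i. \<mu> i + \<nu> i)" "inj_on ?b ?D" "independent (?b ` ?D)"
      "span (?b ` ?D) = UNIV" "\<forall>(i, j)\<in>?D. x (b i j) = (if j > 1 then b i (j - 1) else 0)"
    using nb by (auto simp: is_normal_basis_def is_jordan_basis_def)
  have "inj_on (\<lambda>(i, j). g (b i j)) ?D"
    using comp_inj_on[OF jb(2) inj_on_subset[OF inj]] by (simp add: o_def case_prod_beta')
  moreover have "independent (g ` ?b ` ?D)"
    using jb(3) inj by (intro g.independent_injective_image) (auto intro: inj_on_subset)
  moreover have "span (g ` ?b ` ?D) = UNIV"
    unfolding g.span_image jb(4) by (rule surj)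
  moreover have "\<forall>(i, j)\<in>?D. (g \<circ> x \<circ> inv_into UNIV g) (g (b i j)) =
      (if j > 1 then g (b i (j - 1)) else 0)"
    using jb(5) inj by auto
  ultimately have "is_jordan_basis scale (g \<circ> x \<circ> inv_into UNIV g) (\<lambda>i. \<mu> i + \<nu> i) (\<lambda>i j. g (b i j))"
    unfolding is_jordan_basis_def im using jb(1) by blast
  then show ?thesis
    using nb by (simp add: is_normal_basis_def g.sum)
qed

text \<open>The linear map that matches the two bases box by box sends \<open>v\<close> to
  \<open>v'\<close> and intertwines \<open>x\<close> with \<open>x'\<close>, because both the vector
  and the shift are given by the same formula on boxes.\<close>

lemma normal_bases_conjugate:
  assumes x: "Vector_Spaces.linear scale scale x" and x': "Vector_Spaces.linear scale scale x'"
    and nb: "is_normal_basis scale v x \<mu> \<nu> b" and nb': "is_normal_basis scale v' x' \<mu> \<nu> b'"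
  shows "\<exists>g\<in>carrier (GL_group scale). g v = v' \<and> g \<circ> x \<circ> inv_into UNIV g = x'"
proof -
  interpret pair: vector_space_pair scale scale ..
  let ?l = "\<lambda>i. \<mu> i + \<nu> i"
  let ?D = "young_boxes ?l" and ?b = "\<lambda>(i, j). b i j" and ?b' = "\<lambda>(i, j). b' i j"
  have part: "int_partition \<mu>" "int_partition \<nu>"
    using nb by (auto simp: is_normal_basis_def)
  have jb: "inj_on ?b ?D" "independent (?b ` ?D)" "span (?b ` ?D) = UNIV"
      "\<forall>(i, j)\<in>?D. x (b i j) = (if j > 1 then b i (j - 1) else 0)"
    and v: "v = (\<Sum>i<partition_length \<mu>. b i (\<mu> i))"
    using nb by (auto simp: is_normal_basis_def is_jordan_basis_def)
  have jb': "span (?b' ` ?D) = UNIV"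
      "\<forall>(i, j)\<in>?D. x' (b' i j) = (if j > 1 then b' i (j - 1) else 0)"
    and v': "v' = (\<Sum>i<partition_length \<mu>. b' i (\<mu> i))"
    using nb' by (auto simp: is_normal_basis_def is_jordan_basis_def)
  obtain g where g: "Vector_Spaces.linear scale scale g"
    and "\<forall>y\<in>?b ` ?D. g y = (?b' \<circ> inv_into ?D ?b) y"
    using pair.linear_independent_extend[OF jb(2)] by blast
  then have gb: "g (b i j) = b' i j" if "(i, j) \<in> ?D" for i j
    using that inv_into_f_f[OF jb(1) that] by force
  interpret g: module_hom scale scale g
    using g by (simp add: linear_iff_module_hom)
  have im: "g ` ?b ` ?D = ?b' ` ?D"
    unfolding image_image using gb by (intro image_cong) auto
  have surj: "surj g"
    \<comment> \<open>The second basis spans, so \<open>g\<close> is onto; in finite dimension it is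
      then invertible.\<close>
    using g.span_image[of "?b ` ?D"] jb(3) jb'(1) im by simp
  with g have inj: "inj g" by (rule linear_surj_imp_inj)
  have G: "g \<in> carrier (GL_group scale)"
    using g inj surj by (simp add: GL_group_def bij_def)
  have gv: "g v = v'"
  proof -
    have "(i, \<mu> i) \<in> ?D" if "i < partition_length \<mu>" for i
      using nonzero_part_iff[OF part(1), of i] that part by (simp add: young_boxes_add_iff)
    then show ?thesis
      unfolding v v' g.sum using gb by (intro sum.cong) auto
  qed
  have eq: "(g \<circ> x) z = (x' \<circ> g) z" if "z \<in> ?b ` ?D" for z
  proof -
    from that obtain i j where z: "z = b i j" and ij: "(i, j) \<in> ?D" by auto
    have "(i, j - 1) \<in> ?D" if "j > 1"
      using ij that by (auto simp: young_boxes_def)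
    then have "g (if j > 1 then b i (j - 1) else 0) = (if j > 1 then b' i (j - 1) else 0)"
      using gb by simp
    then show "(g \<circ> x) z = (x' \<circ> g) z"
      using bspec[OF jb(4) ij] bspec[OF jb'(2) ij] gb[OF ij] unfolding z by simp
  qed
  have "(g \<circ> x) y = (x' \<circ> g) y" for y
    using pair.linear_eq_on[OF Vector_Spaces.linear_compose[OF x g]
        Vector_Spaces.linear_compose[OF g x'] _ eq] jb(3) by blast
  then have "g \<circ> x \<circ> inv_into UNIV g = x'"
    using surj by (auto simp: fun_eq_iff surj_f_inv_f)
  with G gv show ?thesis by blast
qed

text \<open>Label the given basis by the boxes in any bijective way, let \<open>x\<close> be the
  left shift along rows, and read \<open>v\<close> off from \<mu>.\<close>

lemma exists_of_type:
  assumes "(\<mu>, \<nu>) \<in> bipartitions (dim UNIV)"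
  shows "\<exists>v x b. x \<in> nilpotent_endos scale \<and> is_normal_basis scale v x \<mu> \<nu> b"
proof -
  interpret pair: vector_space_pair scale scale ..
  let ?l = "\<lambda>i. \<mu> i + \<nu> i"
  let ?D = "young_boxes ?l"
  have part: "int_partition \<mu>" "int_partition \<nu>" "int_partition ?l"
    using assms by (auto simp: bipartitions_def int_partition_add)
  have "card ?D = card Basis"
    using assms part by (simp add: card_young_boxes partition_size_add bipartitions_def)
  then obtain f where f: "bij_betw f ?D Basis"
    using finite_same_card_bij[of ?D Basis] finite_Basis by auto
  define b where "b i j = f (i, j)" for i j
  have f_eq: "f = (\<lambda>(i, j). b i j)"
    by (simp add: b_def fun_eq_iff)
  obtain x where x: "Vector_Spaces.linear scale scale x"
    and "\<forall>y\<in>Basis. x y = (case inv_into ?D f y of (i, j) \<Rightarrow> if j > 1 then b i (j - 1) else 0)"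
    using pair.linear_independent_extend[OF independent_Basis,
        of "\<lambda>y. case inv_into ?D f y of (i, j) \<Rightarrow> if j > 1 then b i (j - 1) else 0"]
    by blast
  moreover have "f p \<in> Basis" "inv_into ?D f (f p) = p" if "p \<in> ?D" for p
    using f that by (auto simp: bij_betw_def)
  ultimately have xb: "x (b i j) = (if j > 1 then b i (j - 1) else 0)" if "(i, j) \<in> ?D" for i j
    using that by (simp add: b_def)
  have jb: "is_jordan_basis scale x ?l b"
    unfolding is_jordan_basis_def f_eq[symmetric]
    using part(3) f xb independent_Basis span_Basis by (auto simp: bij_betw_def)
  \<comment> \<open>Row 0 is the longest, so its length bounds the shifts needed to clear every
    row.\<close>
  have "x ^^ ?l 0 = (\<lambda>_. 0)"
  proof
    fix y
    interpret x: module_hom scale scale x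
      using x by (simp add: linear_iff_module_hom)
    interpret pow: module_hom scale scale "x ^^ ?l 0"
      using linear_funpow[OF x] by (simp add: linear_iff_module_hom)
    have "(x ^^ ?l 0) (b i j) = 0" if "(i, j) \<in> ?D" for i j
    proof -
      have ij: "1 \<le> j" "j \<le> ?l i"
        using that part(1,2) by (auto simp: young_boxes_add_iff)
      moreover have "?l i \<le> ?l 0"
        using part(3) antimonoD[of ?l 0 i] by (simp add: int_partition_def)
      ultimately show ?thesis
        using jordan_basis_funpow[OF jb x.zero ij, of "?l 0"] by simp
    qed
    then have "(x ^^ ?l 0) z = 0" if "z \<in> Basis" for z
      using that f by (force simp: bij_betw_def f_eq)
    then show "(x ^^ ?l 0) y = 0"
      by (rule pow.eq_0_on_span) (use span_Basis in auto)
  qed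
  then have "x \<in> nilpotent_endos scale"
    unfolding nilpotent_endos_def using x by blast
  moreover have "is_normal_basis scale (\<Sum>i<partition_length \<mu>. b i (\<mu> i)) x \<mu> \<nu> b"
    using part jb by (simp add: is_normal_basis_def)
  ultimately show ?thesis by blast
qed

definition normal_stratum :: "(nat \<Rightarrow> nat) \<Rightarrow> (nat \<Rightarrow> nat) \<Rightarrow> ('b \<times> ('b \<Rightarrow> 'b)) set" where
  "normal_stratum \<mu> \<nu> = {(v, x). x \<in> nilpotent_endos scale \<and> (\<exists>b. is_normal_basis scale v x \<mu> \<nu> b)}"

text \<open>Transport of a normal basis along \<open>g\<close> keeps the orbit inside the stratum;
  conjugacy of any two normal bases of the same type makes the action transitive on it.\<close>

lemma orbit_eq_normal_stratum:
  assumes "(v, x) \<in> normal_stratum \<mu> \<nu>"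
  shows "orbit (GL_group scale) (GL_action scale) (v, x) = normal_stratum \<mu> \<nu>"
proof -
  obtain b where x: "x \<in> nilpotent_endos scale" and nb: "is_normal_basis scale v x \<mu> \<nu> b"
    using assms by (auto simp: normal_stratum_def)
  have act: "GL_action scale g (v, x) = (g v, g \<circ> x \<circ> inv_into UNIV g)" for g
    using x by (simp add: GL_action_def)
  show ?thesis
  proof (intro equalityI subsetI)
    fix p assume "p \<in> orbit (GL_group scale) (GL_action scale) (v, x)"
    then obtain g where "g \<in> carrier (GL_group scale)" "p = (g v, g \<circ> x \<circ> inv_into UNIV g)"
      by (auto simp: orbit_def act)
    then show "p \<in> normal_stratum \<mu> \<nu>"
      using normal_basis_conjugate[OF _ nb] conj_nilpotent[OF _ x] by (auto simp: normal_stratum_def)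
  next
    fix p assume "p \<in> normal_stratum \<mu> \<nu>"
    then obtain v' x' b' where p: "p = (v', x')" "x' \<in> nilpotent_endos scale"
        "is_normal_basis scale v' x' \<mu> \<nu> b'"
      by (auto simp: normal_stratum_def)
    then obtain g where "g \<in> carrier (GL_group scale)" "g v = v'" "g \<circ> x \<circ> inv_into UNIV g = x'"
      using normal_bases_conjugate[OF _ _ nb p(3)] x by (auto simp: nilpotent_endos_def)
    then show "p \<in> orbit (GL_group scale) (GL_action scale) (v, x)"
      unfolding orbit_def p(1) using act by fastforce
  qed
qed

lemma nilpotent_endomorphism_of_nilpotent_endos:
  "x \<in> nilpotent_endos scale \<Longrightarrow> nilpotent_endomorphism scale Basis x"
  by (auto simp: nilpotent_endomorphism_def nilpotent_endomorphism_axioms_def nilpotent_endos_def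
      intro: finite_dimensional_vector_space_axioms)

text \<open>Strata of bipartitions are nonempty orbits, and a point common to two of them has only
  one type, which gives injectivity. Surjectivity is the existence of a normal basis for every
  pair.\<close>

lemma bij_betw_normal_stratum:
  "bij_betw (\<lambda>(\<mu>, \<nu>). normal_stratum \<mu> \<nu>) (bipartitions (dim UNIV))
     (orbits (GL_group scale) (UNIV \<times> nilpotent_endos scale) (GL_action scale))"
  (is "bij_betw ?F ?Q ?O")
proof (rule bij_betw_imageI)
  have nonempty: "\<exists>v x. (v, x) \<in> normal_stratum \<mu> \<nu>" if "(\<mu>, \<nu>) \<in> ?Q" for \<mu> \<nu>
    using exists_of_type[OF that] by (auto simp: normal_stratum_def)
  show "inj_on ?F ?Q"
  proof (rule inj_onI, clarify)
    fix \<mu> \<nu> \<mu>' \<nu>'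
    assume "(\<mu>, \<nu>) \<in> ?Q" and eq: "normal_stratum \<mu> \<nu> = normal_stratum \<mu>' \<nu>'"
    then obtain v x where vx: "(v, x) \<in> normal_stratum \<mu> \<nu>" "(v, x) \<in> normal_stratum \<mu>' \<nu>'"
      using nonempty by blast
    then obtain b b' where x: "x \<in> nilpotent_endos scale"
      and nb: "is_normal_basis scale v x \<mu> \<nu> b" "is_normal_basis scale v x \<mu>' \<nu>' b'"
      by (auto simp: normal_stratum_def)
    interpret nilpotent_endomorphism scale Basis x
      using x by (rule nilpotent_endomorphism_of_nilpotent_endos)
    show "\<mu> = \<mu>' \<and> \<nu> = \<nu>'"
      using normal_type_unique[OF nb] by simp
  qed
  show "?F ` ?Q = ?O"
  proof (intro equalityI subsetI)
    fix S assume "S \<in> ?F ` ?Q"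
    then obtain \<mu> \<nu> where S: "(\<mu>, \<nu>) \<in> ?Q" "S = normal_stratum \<mu> \<nu>" by auto
    with nonempty obtain v x where vx: "(v, x) \<in> normal_stratum \<mu> \<nu>" by blast
    then have "(v, x) \<in> UNIV \<times> nilpotent_endos scale"
      by (simp add: normal_stratum_def)
    then show "S \<in> ?O"
      unfolding orbits_def S(2) using orbit_eq_normal_stratum[OF vx] by blast
  next
    fix S assume "S \<in> ?O"
    then obtain v x where x: "x \<in> nilpotent_endos scale"
      and S: "S = orbit (GL_group scale) (GL_action scale) (v, x)"
      by (auto simp: orbits_def)
    interpret nilpotent_endomorphism scale Basis x
      using x by (rule nilpotent_endomorphism_of_nilpotent_endos)
    obtain \<mu> \<nu> b where Q: "(\<mu>, \<nu>) \<in> ?Q" and "is_normal_basis scale v x \<mu> \<nu> b"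
      using exists_normal_basis by blast
    then have "(v, x) \<in> normal_stratum \<mu> \<nu>"
      using x by (auto simp: normal_stratum_def)
    then have "S = ?F (\<mu>, \<nu>)"
      using S orbit_eq_normal_stratum by simp
    then show "S \<in> ?F ` ?Q"
      using Q by (rule image_eqI)
  qed
qed

end

theorem proposition2p3:
  fixes scale :: "'f::alg_closed_field \<Rightarrow> 'v::ab_group_add \<Rightarrow> 'v"
    and B :: "'v set" and n :: nat
  assumes "finite_dimensional_vector_space scale B"
    and "vector_space.dim scale (UNIV :: 'v set) = n"
  shows "bij_betw
           (\<lambda>(\<mu>, \<nu>). {(v, x). x \<in> nilpotent_endos scale \<and> (\<exists>b. is_normal_basis scale v x \<mu> \<nu> b)})
           (bipartitions n)
           (orbits (GL_group scale) (UNIV \<times> nilpotent_endos scale) (GL_action scale))"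
proof -
  interpret finite_dimensional_vector_space scale B by fact
  show ?thesis
    using bij_betw_normal_stratum unfolding assms(2) normal_stratum_def .
qed

end
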